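(* Let $(\underline{\Pi}_x^n,\overline{\Pi}_x^n)$ be the probabilistic predictor constructed (as described in the context) from functions $\phi_n:\mathbb{Z}^n\times\mathbb{Z}\to\mathbb{R}$ and nested random sets $\mathcal{U}\sim\mathsf{R}_n$, i.e. $$\underline{\Pi}_x^n(A)=\mathsf{R}_n\{\mathbb{Y}_x^n(\mathcal{U})\subseteq A\},\qquad \overline{\Pi}_x^n(A)=\mathsf{R}_n\{\mathbb{Y}_x^n(\mathcal{U})\cap A\neq\varnothing\},\qquad A\in\mathcal{A},$$ or equivalently the one determined by $\overline{\Pi}_x^n(A)=\sup_{y\in A}\pi_x^n(y)$ with $\pi_x^n(y)=\mathsf{R}_n\{\mathbb{Y}_x^n(\mathcal{U})\ni y\}$. Suppose that, for each $n$: (i) with $f(u)=\mathsf{R}_n(\mathcal{U}\ni u)$, if $U\sim\mathsf{Q}_n$, then $f(U)$ is uniformly distributed on $\{\frac{1}{n+1},\frac{2}{n+1},\ldots,\frac{n}{n+1},1\}$; and (ii) for every $\mathsf{P}\in\mathscr{P}$ and for $\mathsf{P}$-almost all $(Z^n,X_{n+1})$, the random set $\mathbb{Y}_{X_{n+1}}^n(\mathcal{U})$ is non-empty with $\mathsf{R}_n$-probability $1$. Then the probabilistic predictor is uniformly valid, that is, $$\sup_{\mathsf{P}\in\mathscr{P}}\mathsf{P}\{\pi_{X_{n+1}}^n(Y_{n+1})\le\alpha\}\le\alpha\quad\text{for all }\alpha\in[0,1]\text{ and all }n\ge1.$$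
   Context: Data. $Z_1,Z_2,\ldots$ is an exchangeable process, $Z_i=(X_i,Y_i)\in\mathbb{Z}=\mathbb{X}\times\mathbb{Y}$, with $\mathbb{X}\subseteq\mathbb{R}^d$ and $\mathbb{Y}\subseteq\mathbb{R}$. Its joint distribution $\mathsf{P}$ is unknown, belonging to a model $\mathscr{P}$, a set of exchangeable distributions. Write $Z^n=(Z_1,\ldots,Z_n)$. $\mathcal{A}$ is a $\sigma$-algebra of (measurable) subsets of $\mathbb{Y}$ containing all singletons. All maps involved are assumed measurable as needed. Construction (inferential model for prediction). For each $n\ge 1$: A-step: $\phi_n:\mathbb{Z}^n\times\mathbb{Z}\to\mathbb{R}$ is a function such that the distribution $\mathsf{Q}_n$ of $\phi_n(Z^n,Z_{n+1})$ is the same for all $\mathsf{P}\in\mathscr{P}$. $\mathsf{Q}_n$ is the distribution of an auxiliary variable $U$ taking values in a discrete (countable) space $\mathbb{U}$. For data $Z^n$, a value $x$ of $X_{n+1}$, and $u\in\mathbb{U}$, put $\mathbb{Y}_x^n(u)=\{y\in\mathbb{Y}:\phi_n(Z^n,(x,y))=u\}$. P-step: $\mathcal{U}$ is a random subset of $\mathbb{U}$ with distribution $\mathsf{R}_n$ (not depending on the data), nested in the sense that for any two sets in its support one is a subset of the other. C-step: $\mathbb{Y}_x^n(\mathcal{U})=\bigcup_{u\in\mathcal{U}}\mathbb{Y}_x^n(u)=\{y\in\mathbb{Y}:\phi_n(Z^n,(x,y))\in\mathcal{U}\}$. The probabilistic predictor for $Y_{n+1}$ is the pair $(\underline{\Pi}_x^n,\overline{\Pi}_x^n)$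 of lower and upper probabilities defined by the formulas in the claim. The dependence on $Z^n$ is indicated only by the superscript $n$. The plausibility contour is $\pi_x^n(y)=\overline{\Pi}_x^n(\{y\})=\mathsf{R}_n\{\mathbb{Y}_x^n(\mathcal{U})\ni y\}$. *)

theory Defs
  imports "HOL-Probability.Probability"
begin

abbreviation obs_space :: "(real ^ 'd) set \<Rightarrow> real set \<Rightarrow> ((real ^ 'd) \<times> real) measure" where
  "obs_space X Y \<equiv> restrict_space borel (X \<times> Y)"

text \<open>The path space of \<open>Z\<^sub>1, Z\<^sub>2, \<dots>\<close>; a path is a function on the positive integers
  (extensional, i.e. \<open>undefined\<close> at \<open>0\<close>).\<close>

abbreviation path_space ::
    "(real ^ 'd) set \<Rightarrow> real set \<Rightarrow> (nat \<Rightarrow> (real ^ 'd) \<times> real) measure" where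
  "path_space X Y \<equiv> PiM {1..} (\<lambda>_. obs_space X Y)"

abbreviation data_space ::
    "(real ^ 'd) set \<Rightarrow> real set \<Rightarrow> nat \<Rightarrow> (nat \<Rightarrow> (real ^ 'd) \<times> real) measure" where
  "data_space X Y n \<equiv> PiM {1..n} (\<lambda>_. obs_space X Y)"

definition exchangeable ::
    "(real ^ 'd) set \<Rightarrow> real set \<Rightarrow> (nat \<Rightarrow> (real ^ 'd) \<times> real) measure \<Rightarrow> bool" where
  "exchangeable X Y P \<longleftrightarrow>
     prob_space P \<and> sets P = sets (path_space X Y) \<and>
     (\<forall>n p. p permutes {1..n} \<longrightarrow>
        distr P (data_space X Y n) (\<lambda>\<omega>. \<lambda>i\<in>{1..n}. \<omega> (p i)) =
        distr P (data_space X Y n) (\<lambda>\<omega>. restrict \<omega> {1..n}))"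

text \<open>The \<open>\<sigma>\<close>-algebra on \<open>Pow U\<close> is the one making every event \<open>u \<in> S\<close> measurable. For countable
  \<open>U\<close> it is the Borel \<open>\<sigma>\<close>-algebra of the product topology on \<open>Pow U = {0,1}\<^sup>U\<close>.\<close>

definition subset_space :: "real set \<Rightarrow> real set measure" where
  "subset_space U = sigma (Pow U) ((\<lambda>u. {S. S \<subseteq> U \<and> u \<in> S}) ` U)"

text \<open>The topological support of a law on \<open>Pow U\<close>: the sets \<open>{T. T \<inter> F = S \<inter> F}\<close> with \<open>F\<close> finite
  are the basic neighbourhoods of \<open>S\<close> in the product topology.\<close>

definition set_support :: "real set \<Rightarrow> real set measure \<Rightarrow> real set set" where
  "set_support U R =
     {S. S \<subseteq> U \<and> (\<forall>F. finite F \<and> F \<subseteq> U \<longrightarrow> measure R {T \<in> space R. T \<inter> F = S \<inter> F} > 0)}"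

definition nested_random_set :: "real set \<Rightarrow> real set measure \<Rightarrow> bool" where
  "nested_random_set U R \<longleftrightarrow>
     prob_space R \<and> sets R = sets (subset_space U) \<and>
     (\<forall>S \<in> set_support U R. \<forall>T \<in> set_support U R. S \<subseteq> T \<or> T \<subseteq> S)"

definition pred_set ::
    "real set \<Rightarrow> ('z \<Rightarrow> 'x \<times> real \<Rightarrow> real) \<Rightarrow> 'z \<Rightarrow> 'x \<Rightarrow> real set \<Rightarrow> real set" where
  "pred_set Y \<phi> z x S = {y \<in> Y. \<phi> z (x, y) \<in> S}"

definition lower_prob ::
    "real set \<Rightarrow> ('z \<Rightarrow> 'x \<times> real \<Rightarrow> real) \<Rightarrow> real set measure \<Rightarrow> 'z \<Rightarrow> 'x \<Rightarrow> real set \<Rightarrow> real" where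
  "lower_prob Y \<phi> R z x A = measure R {S \<in> space R. pred_set Y \<phi> z x S \<subseteq> A}"

definition upper_prob ::
    "real set \<Rightarrow> ('z \<Rightarrow> 'x \<times> real \<Rightarrow> real) \<Rightarrow> real set measure \<Rightarrow> 'z \<Rightarrow> 'x \<Rightarrow> real set \<Rightarrow> real" where
  "upper_prob Y \<phi> R z x A = measure R {S \<in> space R. pred_set Y \<phi> z x S \<inter> A \<noteq> {}}"

text \<open>A predictor maps the sample size \<open>n\<close>, the data \<open>(Z\<^sub>1, \<dots>, Z\<^sub>n)\<close> and the value \<open>x\<close> of
  \<open>X\<^sub>n\<^sub>+\<^sub>1\<close> to a pair (lower probability, upper probability).\<close>

type_synonym 'x predictor =
  "nat \<Rightarrow> (nat \<Rightarrow> 'x \<times> real) \<Rightarrow> 'x \<Rightarrow> (real set \<Rightarrow> real) \<times> (real set \<Rightarrow> real)"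

definition im_predictor ::
    "real set \<Rightarrow> (nat \<Rightarrow> (nat \<Rightarrow> 'x \<times> real) \<Rightarrow> 'x \<times> real \<Rightarrow> real) \<Rightarrow> (nat \<Rightarrow> real set measure)
      \<Rightarrow> 'x predictor" where
  "im_predictor Y \<phi> R n z x = (lower_prob Y (\<phi> n) (R n) z x, upper_prob Y (\<phi> n) (R n) z x)"

definition contour :: "'x predictor \<Rightarrow> nat \<Rightarrow> (nat \<Rightarrow> 'x \<times> real) \<Rightarrow> 'x \<Rightarrow> real \<Rightarrow> real" where
  "contour \<Psi> n z x y = snd (\<Psi> n z x) {y}"

lemma contour_im_predictor:
  assumes "y \<in> Y"
  shows "contour (im_predictor Y \<phi> R) n z x y =
    measure (R n) {S \<in> space (R n). y \<in> pred_set Y (\<phi> n) z x S}"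
  by (simp add: contour_def im_predictor_def upper_prob_def)

definition uniformly_valid ::
    "(nat \<Rightarrow> 'x \<times> real) measure set \<Rightarrow> 'x predictor \<Rightarrow> bool" where
  "uniformly_valid \<P> \<Psi> \<longleftrightarrow>
     (\<forall>n \<ge> 1. \<forall>\<alpha> \<in> {0..1}.
        (SUP P \<in> \<P>. measure P {\<omega> \<in> space P.
            contour \<Psi> n (restrict \<omega> {1..n}) (fst (\<omega> (n + 1))) (snd (\<omega> (n + 1))) \<le> \<alpha>}) \<le> \<alpha>)"

end

theory Submission
  imports Defs
begin

text \<open>
  With \<open>f(u) = R\<^sub>n(u \<in> \<U>)\<close>, the contour at \<open>(X\<^sub>n\<^sub>+\<^sub>1, Y\<^sub>n\<^sub>+\<^sub>1)\<close> is \<open>f(\<phi>\<^sub>n(Z\<^sup>n, Z\<^sub>n\<^sub>+\<^sub>1))\<close>, hence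
  uniform on \<open>{1/(n+1), \<dots>, 1}\<close>, and such a variable is stochastically at least as large as a
  uniform one on \<open>[0,1]\<close>. For the supremum formula, the topological support carries full mass
  because \<open>Pow U\<close> has a countable base. On the support, nestedness makes the events \<open>u \<in> \<U>\<close> a chain,
  so a finite union of them has the probability of its largest member, and continuity from below
  extends this to the countable union.
\<close>

text \<open>Up to a null set, a finite nonempty union from a chain lies in its largest member, so
  the bound \<open>c\<close> passes to finite unions and then, by continuity from below, to the
  countable one. Inclusions hold only almost everywhere because nestedness is imposed on the support
  alone.\<close>

lemma (in finite_measure) measure_UN_AE_chain_le:
  assumes "countable I" and E: "\<And>i. i \<in> I \<Longrightarrow> E i \<in> sets M"
    and chain: "\<And>i j. i \<in> I \<Longrightarrow> j \<in> I \<Longrightarrow>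
      (AE x in M. x \<in> E i \<longrightarrow> x \<in> E j) \<or> (AE x in M. x \<in> E j \<longrightarrow> x \<in> E i)"
    and le: "\<And>i. i \<in> I \<Longrightarrow> measure M (E i) \<le> c" and "0 \<le> c"
  shows "measure M (\<Union>i\<in>I. E i) \<le> c"
proof (cases "I = {}")
  case True
  then show ?thesis using \<open>0 \<le> c\<close> by simp
next
  case False
  have dominated: "\<exists>j\<in>I. AE x in M. x \<in> (\<Union>i\<in>F. E i) \<longrightarrow> x \<in> E j"
    if "finite F" "F \<noteq> {}" "F \<subseteq> I" for F
    using that
  proof (induction rule: finite_ne_induct)
    case (singleton i)
    then show ?case by auto
  next
    case (insert i F)
    then obtain j where j: "j \<in> I" "AE x in M. x \<in> (\<Union>i\<in>F. E i) \<longrightarrow> x \<in> E j" by auto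
    have "i \<in> I" using insert by auto
    from chain[OF this j(1)] show ?case
    proof
      assume "AE x in M. x \<in> E i \<longrightarrow> x \<in> E j"
      with j(2) have "AE x in M. x \<in> (\<Union>i\<in>insert i F. E i) \<longrightarrow> x \<in> E j"
        by eventually_elim auto
      with j(1) show ?thesis by blast
    next
      assume "AE x in M. x \<in> E j \<longrightarrow> x \<in> E i"
      with j(2) have "AE x in M. x \<in> (\<Union>i\<in>insert i F. E i) \<longrightarrow> x \<in> E i"
        by eventually_elim auto
      with \<open>i \<in> I\<close> show ?thesis by blast
    qed
  qed
  \<comment> \<open>\<open>from_nat_into I\<close> enumerates \<open>I\<close>, with repetitions if
    \<open>I\<close> is finite, so the \<open>D m\<close> are nonempty finite unions increasing to
    the full one.\<close>
  define D where "D m = (\<Union>i\<in>from_nat_into I ` {..m}. E i)" for m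
  have sub: "from_nat_into I ` {..m} \<subseteq> I" for m
    using from_nat_into[OF False] by auto
  have "measure M (D m) \<le> c" for m
  proof -
    obtain j where j: "j \<in> I" "AE x in M. x \<in> D m \<longrightarrow> x \<in> E j"
      using dominated[of "from_nat_into I ` {..m}"] sub[of m] unfolding D_def by auto
    have "measure M (D m) \<le> measure M (E j)"
      using j E by (intro finite_measure_mono_AE) auto
    with le[OF j(1)] show ?thesis by simp
  qed
  moreover have "range D \<subseteq> sets M"
    using sub E unfolding D_def by (auto intro!: sets.finite_UN)
  moreover have "incseq D"
    unfolding D_def by (intro monoI UN_mono image_mono) auto
  ultimately have "measure M (\<Union>m. D m) \<le> c"
    by (intro LIMSEQ_le_const2[OF finite_Lim_measure_incseq]) auto
  also have "(\<Union>m. D m) = (\<Union>i\<in>I. E i)"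
  proof -
    have "(\<Union>m. D m) = (\<Union>i\<in>range (from_nat_into I). E i)"
      unfolding D_def by blast
    then show ?thesis
      using False \<open>countable I\<close> by (simp add: range_from_nat_into)
  qed
  finally show ?thesis .
qed

lemma space_subset_space: "space (subset_space U) = Pow U"
  unfolding subset_space_def by (rule space_measure_of) auto

locale nested_random_set_law =
  fixes U :: "real set" and R :: "real set measure"
  assumes countable_U: "countable U" and nested: "nested_random_set U R"
begin

sublocale prob_space R
  using nested by (simp add: nested_random_set_def)

lemma space_R: "space R = Pow U"
  using nested sets_eq_imp_space_eq[of R "subset_space U"]
  by (simp add: nested_random_set_def space_subset_space)

text \<open>The generators cover only \<open>u \<in> U\<close>, but values of \<open>\<phi>\<close>
  may fall outside \<open>U\<close>; there the event is empty.\<close>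

lemma sets_member: "{S \<in> space R. u \<in> S} \<in> sets R"
proof (cases "u \<in> U")
  case True
  have "{S \<in> space R. u \<in> S} \<in> sets (subset_space U)"
    using True unfolding space_R subset_space_def by (auto simp: Pow_def)
  then show ?thesis
    using nested by (simp add: nested_random_set_def)
next
  case False
  then have "{S \<in> space R. u \<in> S} = {}" by (auto simp: space_R)
  then show ?thesis by (simp only: sets.empty_sets)
qed

lemma sets_trace:
  assumes "finite F"
  shows "{T \<in> space R. T \<inter> F = G \<inter> F} \<in> sets R"
proof -
  have "{T \<in> space R. T \<inter> F = G \<inter> F} = {T \<in> space R. \<forall>u\<in>F. u \<in> T \<longleftrightarrow> u \<in> G}"
    by auto
  also have "\<dots> \<in> sets R"
    using assms sets_member by (intro sets.sets_Collect_finite_All sets.sets_Collect) auto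
  finally show ?thesis .
qed

text \<open>A set outside the support has a basic neighbourhood of measure zero, and there are only
  countably many basic neighbourhoods.\<close>

lemma AE_set_support: "AE S in R. S \<in> set_support U R"
proof -
  define \<F> where "\<F> = {F. finite F \<and> F \<subseteq> U}"
  \<comment> \<open>A basic neighbourhood depends only on \<open>F\<close> and on the trace on
    \<open>F\<close>. Taking \<open>G\<close> finite keeps the family countable even if
    \<open>Pow U\<close> is not.\<close>
  define \<N> where "\<N> = {(F, G). F \<in> \<F> \<and> G \<in> \<F> \<and> measure R {T \<in> space R. T \<inter> F = G \<inter> F} = 0}"
  have "countable \<F>"
    unfolding \<F>_def using countable_Collect_finite_subset[OF countable_U] by simp
  then have "countable \<N>"
    by (intro countable_subset[of \<N> "\<F> \<times> \<F>"]) (auto simp: \<N>_def)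
  have "AE S in R. \<forall>(F, G)\<in>\<N>. S \<inter> F \<noteq> G \<inter> F"
    unfolding AE_ball_countable[OF \<open>countable \<N>\<close>]
  proof safe
    fix F G assume "(F, G) \<in> \<N>"
    then have "{T \<in> space R. T \<inter> F = G \<inter> F} \<in> null_sets R"
      by (intro null_setsI sets_trace) (auto simp: \<N>_def \<F>_def emeasure_eq_measure)
    then show "AE S in R. S \<inter> F \<noteq> G \<inter> F"
      by (rule AE_I') auto
  qed
  with AE_space show ?thesis
  proof eventually_elim
    case (elim S)
    have "measure R {T \<in> space R. T \<inter> F = S \<inter> F} > 0" if "finite F" "F \<subseteq> U" for F
    proof (rule ccontr)
      assume "\<not> ?thesis"
      then have "measure R {T \<in> space R. T \<inter> F = S \<inter> F \<inter> F} = 0"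
        using measure_nonneg[of R "{T \<in> space R. T \<inter> F = S \<inter> F}"] by (simp add: Int_assoc)
      with that have "(F, S \<inter> F) \<in> \<N>" by (auto simp: \<N>_def \<F>_def)
      with elim(2) show False by auto
    qed
    with elim(1) show ?case by (auto simp: set_support_def space_R)
  qed
qed

text \<open>If both inclusions failed on the support, a set containing \<open>u\<close> but not
  \<open>v\<close> and one containing \<open>v\<close> but not \<open>u\<close> would be
  incomparable.\<close>

lemma AE_member_chain:
  "(AE S in R. u \<in> S \<longrightarrow> v \<in> S) \<or> (AE S in R. v \<in> S \<longrightarrow> u \<in> S)"
proof (cases "\<forall>S\<in>set_support U R. u \<in> S \<longrightarrow> v \<in> S")
  case True
  from AE_set_support have "AE S in R. u \<in> S \<longrightarrow> v \<in> S"
    by eventually_elim (use True in auto)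
  then show ?thesis ..
next
  case False
  with nested have *: "\<forall>S\<in>set_support U R. v \<in> S \<longrightarrow> u \<in> S"
    unfolding nested_random_set_def by blast
  from AE_set_support have "AE S in R. v \<in> S \<longrightarrow> u \<in> S"
    by eventually_elim (use * in auto)
  then show ?thesis ..
qed

text \<open>Intersecting with \<open>U\<close> makes the union countable even for uncountable
  \<open>B\<close>.\<close>

lemma hits_eq_UN: "{S \<in> space R. S \<inter> B \<noteq> {}} = (\<Union>u\<in>B \<inter> U. {S \<in> space R. u \<in> S})"
  by (auto simp: space_R)

lemma sets_hits: "{S \<in> space R. S \<inter> B \<noteq> {}} \<in> sets R"
  unfolding hits_eq_UN using countable_U sets_member
  by (intro sets.countable_UN') auto

text \<open>This is the maxitivity of a nested random set: its hitting probability is a possibility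
  measure. Points of \<open>B\<close> outside \<open>U\<close> contribute 0 to the supremum.\<close>

lemma measure_hits_eq_SUP:
  assumes "B \<noteq> {}"
  shows "measure R {S \<in> space R. S \<inter> B \<noteq> {}} = (SUP u\<in>B. measure R {S \<in> space R. u \<in> S})"
    (is "_ = ?s")
proof (rule antisym)
  have bdd: "bdd_above ((\<lambda>u. measure R {S \<in> space R. u \<in> S}) ` B)"
    by (intro bdd_aboveI2[of _ _ 1]) simp
  show "measure R {S \<in> space R. S \<inter> B \<noteq> {}} \<le> ?s"
    unfolding hits_eq_UN
  proof (rule measure_UN_AE_chain_le)
    fix u v
    show "(AE S in R. S \<in> {S \<in> space R. u \<in> S} \<longrightarrow> S \<in> {S \<in> space R. v \<in> S}) \<or>
      (AE S in R. S \<in> {S \<in> space R. v \<in> S} \<longrightarrow> S \<in> {S \<in> space R. u \<in> S})"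
      using AE_member_chain[of u v] by (auto elim: eventually_mono)
  next
    \<comment> \<open>Nonnegativity of the bound covers the case in which \<open>B\<close> is
      nonempty but misses \<open>U\<close>.\<close>
    obtain u where "u \<in> B" using assms by auto
    from cSUP_upper[OF this bdd] show "0 \<le> ?s"
      by (rule order_trans[OF measure_nonneg])
  qed (use countable_U sets_member bdd in \<open>auto intro: cSUP_upper\<close>)
  show "?s \<le> measure R {S \<in> space R. S \<inter> B \<noteq> {}}"
    using assms sets_hits by (intro cSUP_least finite_measure_mono) auto
qed

text \<open>The function vanishes off the countable set \<open>U\<close>, so it differs from a
  constant at countably many points only.\<close>

lemma borel_measurable_member:
  "(\<lambda>u. measure R {S \<in> space R. u \<in> S}) \<in> borel_measurable borel"
proof (rule measurable_discrete_difference[of "\<lambda>_. 0" _ _ U])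
  fix u assume "u \<notin> U"
  then have "{S \<in> space R. u \<in> S} = {}" by (auto simp: space_R)
  then show "0 = measure R {S \<in> space R. u \<in> S}" by (simp only: measure_empty)
qed (use countable_U in auto)

text \<open>The predicted set meets \<open>A\<close> exactly when the random set meets the image of
  \<open>A\<close> under \<open>\<phi> n z (x, _)\<close>, which reduces the formula to
  maxitivity.\<close>

lemma upper_prob_eq_SUP_contour:
  assumes "A \<noteq> {}" "A \<subseteq> Y" "R' n = R"
  shows "snd (im_predictor Y \<phi> R' n z x) A = (SUP y\<in>A. contour (im_predictor Y \<phi> R') n z x y)"
proof -
  define B where "B = (\<lambda>y. \<phi> n z (x, y)) ` A"
  have "snd (im_predictor Y \<phi> R' n z x) A = measure R {S \<in> space R. S \<inter> B \<noteq> {}}"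
    unfolding im_predictor_def upper_prob_def snd_conv assms(3)
    by (intro arg_cong[where f = "measure R"]) (use assms in \<open>auto simp: pred_set_def B_def\<close>)
  also have "\<dots> = (SUP u\<in>B. measure R {S \<in> space R. u \<in> S})"
    using assms by (intro measure_hits_eq_SUP) (auto simp: B_def)
  also have "\<dots> = (SUP y\<in>A. measure R {S \<in> space R. \<phi> n z (x, y) \<in> S})"
    by (simp add: B_def image_image)
  also have "\<dots> = (SUP y\<in>A. contour (im_predictor Y \<phi> R') n z x y)"
    using assms by (intro SUP_cong refl) (auto simp: contour_im_predictor pred_set_def)
  finally show ?thesis .
qed

end

text \<open>At most \<open>\<lfloor>\<alpha> * m\<rfloor>\<close> of the \<open>m\<close> equally
  likely grid points are \<open>\<le> \<alpha>\<close>, and rounding down gives the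
  inequality.\<close>

lemma measure_uniform_grid_atMost_le:
  fixes \<alpha> :: real
  assumes "0 < m" "0 \<le> \<alpha>"
  shows "measure (distr (uniform_count_measure ((\<lambda>k. real k / real m) ` {1..m})) borel (\<lambda>v. v))
    {..\<alpha>} \<le> \<alpha>"
proof -
  let ?G = "(\<lambda>k. real k / real m) ` {1..m}"
  have inj: "inj_on (\<lambda>k. real k / real m) {1..m}"
    using assms by (auto simp: inj_on_def)
  have "card ({..\<alpha>} \<inter> ?G) \<le> card ((\<lambda>k. real k / real m) ` {1..nat \<lfloor>\<alpha> * real m\<rfloor>})"
  proof (rule card_mono)
    have "k \<le> nat \<lfloor>\<alpha> * real m\<rfloor>" if "real k / real m \<le> \<alpha>" for k
      using that assms by (simp add: le_nat_floor pos_divide_le_eq)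
    then show "{..\<alpha>} \<inter> ?G \<subseteq> (\<lambda>k. real k / real m) ` {1..nat \<lfloor>\<alpha> * real m\<rfloor>}"
      by auto
  qed simp
  also have "\<dots> \<le> nat \<lfloor>\<alpha> * real m\<rfloor>"
    using card_image_le[of "{1..nat \<lfloor>\<alpha> * real m\<rfloor>}"] by simp
  finally have "real (card ({..\<alpha>} \<inter> ?G)) \<le> \<alpha> * real m"
    using assms of_nat_floor[of "\<alpha> * real m"] by (simp add: order_trans[OF of_nat_mono])
  \<comment> \<open>The identity map only transfers the law from the grid to the Borel sets of the
    line.\<close>
  moreover have "measure (distr (uniform_count_measure ?G) borel (\<lambda>v. v)) {..\<alpha>}
      = measure (uniform_count_measure ?G) ({..\<alpha>} \<inter> ?G)"
    by (subst measure_distr)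
      (auto simp: measurable_def space_uniform_count_measure sets_uniform_count_measure)
  moreover have "\<dots> = real (card ({..\<alpha>} \<inter> ?G)) / real m"
    by (subst measure_uniform_count_measure) (auto simp: card_image[OF inj] simp del: One_nat_def)
  ultimately show ?thesis
    using assms by (simp add: pos_divide_le_eq)
qed

theorem theorem1:
  fixes X :: "(real ^ 'd) set" and Y :: "real set" and \<A> :: "real set set"
    and \<P> :: "(nat \<Rightarrow> (real ^ 'd) \<times> real) measure set"
    and \<phi> :: "nat \<Rightarrow> (nat \<Rightarrow> (real ^ 'd) \<times> real) \<Rightarrow> (real ^ 'd) \<times> real \<Rightarrow> real"
    and U :: "nat \<Rightarrow> real set" and Q :: "nat \<Rightarrow> real measure" and R :: "nat \<Rightarrow> real set measure"
  assumes "sigma_algebra Y \<A>" and "\<A> \<subseteq> sets (restrict_space borel Y)"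
    and "\<And>y. y \<in> Y \<Longrightarrow> {y} \<in> \<A>"
    and "\<P> \<noteq> {}" and "\<And>P. P \<in> \<P> \<Longrightarrow> exchangeable X Y P"
    and "\<And>n. n \<ge> 1 \<Longrightarrow>
      (\<lambda>(z, w). \<phi> n z w) \<in> borel_measurable (data_space X Y n \<Otimes>\<^sub>M obs_space X Y)"
    and "\<And>n P. n \<ge> 1 \<Longrightarrow> P \<in> \<P> \<Longrightarrow>
      distr P borel (\<lambda>\<omega>. \<phi> n (restrict \<omega> {1..n}) (\<omega> (n + 1))) = Q n"
    and "\<And>n. n \<ge> 1 \<Longrightarrow> countable (U n)" and "\<And>n. n \<ge> 1 \<Longrightarrow> AE u in Q n. u \<in> U n"
    and "\<And>n. n \<ge> 1 \<Longrightarrow> nested_random_set (U n) (R n)"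
    and uniform: "\<And>n. n \<ge> 1 \<Longrightarrow>
      distr (Q n) borel (\<lambda>u. measure (R n) {S \<in> space (R n). u \<in> S}) =
      distr (uniform_count_measure ((\<lambda>k. real k / real (n + 1)) ` {1..n + 1})) borel (\<lambda>v. v)"
    and nonempty: "\<And>n P. n \<ge> 1 \<Longrightarrow> P \<in> \<P> \<Longrightarrow>
      AE \<omega> in P. measure (R n) {S \<in> space (R n).
        pred_set Y (\<phi> n) (restrict \<omega> {1..n}) (fst (\<omega> (n + 1))) S \<noteq> {}} = 1"
  shows "uniformly_valid \<P> (im_predictor Y \<phi> R) \<and>
    (\<forall>n \<ge> 1. \<forall>z \<in> space (data_space X Y n). \<forall>x \<in> X. \<forall>A \<in> \<A>. A \<noteq> {} \<longrightarrow>
      snd (im_predictor Y \<phi> R n z x) A = (SUP y \<in> A. contour (im_predictor Y \<phi> R) n z x y))"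
proof (intro conjI allI impI ballI)
  have law: "nested_random_set_law (U n) (R n)" if "n \<ge> 1" for n
    using assms(8,10) that by unfold_locales auto
  show "uniformly_valid \<P> (im_predictor Y \<phi> R)"
    unfolding uniformly_valid_def
  proof (intro allI impI ballI cSUP_least \<open>\<P> \<noteq> {}\<close>)
    fix n :: nat and \<alpha> :: real and P
    assume n: "n \<ge> 1" and \<alpha>: "\<alpha> \<in> {0..1}" and P: "P \<in> \<P>"
    interpret nested_random_set_law "U n" "R n" using law n .
    let ?f = "\<lambda>u. measure (R n) {S \<in> space (R n). u \<in> S}"
    let ?V = "\<lambda>\<omega>. \<phi> n (restrict \<omega> {1..n}) (\<omega> (n + 1))"
    have sets_P: "sets P = sets (path_space X Y)"
      using assms(5)[OF P] by (simp add: exchangeable_def)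
    then have space_P: "space P = space (path_space X Y)" by (rule sets_eq_imp_space_eq)
    have "(\<lambda>\<omega>. (restrict \<omega> {1..n}, \<omega> (n + 1)))
        \<in> measurable (path_space X Y) (data_space X Y n \<Otimes>\<^sub>M obs_space X Y)"
      by (intro measurable_Pair measurable_restrict_subset measurable_component_singleton) auto
    from measurable_comp[OF this assms(6)[OF n]]
    have V: "?V \<in> borel_measurable P"
      by (simp add: comp_def measurable_cong_sets[OF sets_P refl])
    \<comment> \<open>Off \<open>Y\<close> the contour is 0 whatever \<open>\<phi>\<close> is; on
      \<open>Y\<close> it equals \<open>?f\<close> at the value of \<open>\<phi> n\<close>.\<close>
    have snd_Y: "snd (\<omega> (n + 1)) \<in> Y" if "\<omega> \<in> space P" for \<omega>
    proof -
      have "\<omega> (n + 1) \<in> X \<times> Y"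
        using that by (simp add: space_P space_PiM PiE_iff space_restrict_space)
      then show ?thesis by auto
    qed
    have "measure P {\<omega> \<in> space P. contour (im_predictor Y \<phi> R) n (restrict \<omega> {1..n})
          (fst (\<omega> (n + 1))) (snd (\<omega> (n + 1))) \<le> \<alpha>}
        = measure P (?V -` (?f -` {..\<alpha>}) \<inter> space P)"
      by (intro arg_cong[where f = "measure P"])
        (use snd_Y in \<open>auto simp: contour_im_predictor pred_set_def\<close>)
    \<comment> \<open>The law of \<open>?V\<close> under \<open>P\<close> is \<open>Q n\<close>, so
      the dependence on \<open>P\<close> disappears here and the bound becomes uniform over the
      model.\<close>
    also have "\<dots> = measure (Q n) (?f -` {..\<alpha>} \<inter> space (Q n))"
      using V measurable_sets_borel[OF borel_measurable_member, of "{..\<alpha>}"]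
      by (simp add: assms(7)[OF n P, symmetric] measure_distr)
    also have "\<dots> = measure (distr (Q n) borel ?f) {..\<alpha>}"
      using borel_measurable_member
      by (subst measure_distr) (auto simp: assms(7)[OF n P, symmetric])
    also have "\<dots> \<le> \<alpha>"
      unfolding uniform[OF n] using \<alpha> by (intro measure_uniform_grid_atMost_le) auto
    finally show "measure P {\<omega> \<in> space P. contour (im_predictor Y \<phi> R) n (restrict \<omega> {1..n})
          (fst (\<omega> (n + 1))) (snd (\<omega> (n + 1))) \<le> \<alpha>} \<le> \<alpha>" .
  qed
  fix n :: nat and z A and x :: "real ^ 'd"
  assume n: "n \<ge> 1" and A: "A \<in> \<A>" "A \<noteq> {}"
  \<comment> \<open>The supremum formula requires \<open>A\<close> to lie in \<open>Y\<close>, where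
    the contour is the covering probability.\<close>
  have "\<A> \<subseteq> Pow Y"
    using assms(1) by (simp add: sigma_algebra_iff2)
  with A have "A \<subseteq> Y" by blast
  with A show "snd (im_predictor Y \<phi> R n z x) A =
      (SUP y \<in> A. contour (im_predictor Y \<phi> R) n z x y)"
    by (intro nested_random_set_law.upper_prob_eq_SUP_contour[OF law[OF n]]) simp_all
qed

end
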